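(* Let $g:\mathbb{R}^n\to\mathbb{R}^m$ be an affine map and let $P\subset\mathbb{R}^m$ be non-empty, convex and compact. Suppose that (i) $M:P\rightrightarrows\mathbb{R}^n$ is a convex-valued, lower semi-continuous and closed multi-valued map such that $M(p)$ has non-empty interior for each $p\in P$; (ii) $G:\mathbb{R}^n\rightrightarrows\mathbb{R}^n$ is locally upper sign-continuous and pseudomonotone over the set $\mathrm{co}(M(P))$, where $M(P)=\bigcup_{p\in P}M(p)$. Assume that the coercivity condition $\mathcal{C}(p)$ holds, with constant $r_p>0$, for each $p\in P$, and that there exists some $r>\sup\{r_p : p\in P\}$ such that $M(p)\cap\bar B(0,r)\neq\emptyset$ for every $p\in P$. Then there exist $\bar p\in P$, $\bar y\in M(\bar p)$ and $\bar y^*\in G(\bar y)$ such that $$\langle g(\bar y),p-\bar p\rangle+\langle\bar y^*,z-\bar y\rangle\ge 0\quad\text{for all }(p,z)\in P\times M(\bar p).$$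
   Context: $\bar B(0,r)$ is the closed Euclidean ball of radius $r$ centred at $0$; $\mathrm{co}$ denotes convex hull. A multi-valued map is closed if its graph is closed. Coercivity condition $\mathcal{C}(p)$ with constant $r_p>0$: for every $y\in M(p)\setminus\bar B(0,r_p)$ there exists $z\in M(p)$ with $\|z\|<\|y\|$ such that $\langle y^*,y-z\rangle\ge 0$ for each $y^*\in G(y)$. A map $T:\mathbb{R}^n\rightrightarrows\mathbb{R}^n$ is pseudomonotone over $K\subseteq\mathbb{R}^n$ if for all $v,w\in K$: if there exists $v^*\in T(v)$ with $\langle v^*,w-v\rangle\ge 0$, then $\langle w^*,w-v\rangle\ge 0$ for all $w^*\in T(w)$. A map $T$ is upper sign-continuous over a convex set $K$ if for all $u,v\in K$, with $u_s=su+(1-s)v$: if $\inf_{u_s^*\in T(u_s)}\langle u_s^*,v-u\rangle\ge 0$ for all $s\in(0,1)$, then $\sup_{u^*\in T(u)}\langle u^*,v-u\rangle\ge 0$. A map $T:\mathbb{R}^n\rightrightarrows\mathbb{R}^n$ is locally upper sign-continuous at $u$ if there are a convex open set $\mathcal{O}_u$ containing $u$ and a map $\psi_u:\mathcal{O}_u\rightrightarrows\mathbb{R}^n$ that is upper sign-continuous over $\mathcal{O}_u$ and such that $\psi_u(\tilde u)$ is a non-empty convex compact subset of $T(\tilde u)\setminus\{0\}$ for every $\tilde u\in\mathcal{O}_u$. It is locally upper sign-continuous over a set if it is so at each point of the set. *)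

theory Defs
  imports "HOL-Analysis.Analysis"
begin

text \<open>
  A multi-valued map is rendered as a function into sets. A map that is only given on a set \<open>S\<close>
  is a total function of which only the values on \<open>S\<close> are used.
\<close>

definition affine_map :: "('a::real_vector \<Rightarrow> 'b::real_vector) \<Rightarrow> bool" where
  "affine_map g \<longleftrightarrow> (\<exists>h c. linear h \<and> g = (\<lambda>x. h x + c))"

definition lower_semicontinuous_map_on ::
    "'a::topological_space set \<Rightarrow> ('a \<Rightarrow> 'b::topological_space set) \<Rightarrow> bool" where
  "lower_semicontinuous_map_on S F \<longleftrightarrow>
     (\<forall>x\<in>S. \<forall>V. open V \<and> F x \<inter> V \<noteq> {} \<longrightarrow>
        (\<exists>U. open U \<and> x \<in> U \<and> (\<forall>x'\<in>U \<inter> S. F x' \<inter> V \<noteq> {})))"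

definition closed_graph_on ::
    "'a::topological_space set \<Rightarrow> ('a \<Rightarrow> 'b::topological_space set) \<Rightarrow> bool" where
  "closed_graph_on S F \<longleftrightarrow> closedin (top_of_set (S \<times> UNIV)) {(x, y). x \<in> S \<and> y \<in> F x}"

definition pseudomonotone_over ::
    "'a::real_inner set \<Rightarrow> ('a \<Rightarrow> 'a set) \<Rightarrow> bool" where
  "pseudomonotone_over K T \<longleftrightarrow>
     (\<forall>v\<in>K. \<forall>w\<in>K. (\<exists>v'\<in>T v. v' \<bullet> (w - v) \<ge> 0) \<longrightarrow> (\<forall>w'\<in>T w. w' \<bullet> (w - v) \<ge> 0))"

text \<open>
  The infimum and the supremum are taken in the extended reals, so that they may be infinite;
  over an empty set they are \<open>\<infinity>\<close> and \<open>-\<infinity>\<close>, respectively.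
\<close>

definition upper_sign_continuous_over ::
    "'a::real_inner set \<Rightarrow> ('a \<Rightarrow> 'a set) \<Rightarrow> bool" where
  "upper_sign_continuous_over K T \<longleftrightarrow>
     (\<forall>u\<in>K. \<forall>v\<in>K.
        (\<forall>s\<in>{0<..<1::real}.
           (INF w\<in>T (s *\<^sub>R u + (1 - s) *\<^sub>R v). ereal (w \<bullet> (v - u))) \<ge> 0) \<longrightarrow>
        (SUP w\<in>T u. ereal (w \<bullet> (v - u))) \<ge> 0)"

definition locally_upper_sign_continuous_at ::
    "'a::real_inner \<Rightarrow> ('a \<Rightarrow> 'a set) \<Rightarrow> bool" where
  "locally_upper_sign_continuous_at u T \<longleftrightarrow>
     (\<exists>N \<psi>. open N \<and> convex N \<and> u \<in> N \<and> upper_sign_continuous_over N \<psi> \<and>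
        (\<forall>x\<in>N. \<psi> x \<noteq> {} \<and> convex (\<psi> x) \<and> compact (\<psi> x) \<and> \<psi> x \<subseteq> T x - {0}))"

definition locally_upper_sign_continuous_over ::
    "'a::real_inner set \<Rightarrow> ('a \<Rightarrow> 'a set) \<Rightarrow> bool" where
  "locally_upper_sign_continuous_over K T \<longleftrightarrow>
     (\<forall>u\<in>K. locally_upper_sign_continuous_at u T)"

definition coercivity_condition ::
    "('a::real_inner \<Rightarrow> 'a set) \<Rightarrow> ('p \<Rightarrow> 'a set) \<Rightarrow> 'p \<Rightarrow> real \<Rightarrow> bool" where
  "coercivity_condition G M p \<rho> \<longleftrightarrow>
     (\<forall>y \<in> M p - cball 0 \<rho>. \<exists>z\<in>M p. norm z < norm y \<and> (\<forall>y'\<in>G y. y' \<bullet> (y - z) \<ge> 0))"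

end

theory Submission
  imports Defs
begin

text \<open>
  The inequality decouples into \<open>g y0 \<bullet> (p - p0) \<ge> 0\<close> on \<open>P\<close> and the Stampacchia inequality for
  \<open>y0\<close> on \<open>M p0\<close>. Truncate \<open>M p\<close> to \<open>K p = M p \<inter> cball 0 r\<close>, and let \<open>N p\<close> be the set of all
  \<open>y \<in> K p\<close> that satisfy the Minty inequality against the interior points of \<open>K p\<close> only. Then
  \<open>N p\<close> is convex, and non-empty by pseudomonotonicity and a KKM argument. Its graph is closed
  although \<open>G\<close> has no continuity in the graph sense, because an interior point of \<open>K p\<close> remains one
  for nearby parameters and so can be used as a fixed test point in the limit. Local upper
  sign-continuity, combined with a minimax argument on the compact convex values of \<open>\<psi>\<close>, turns
  points of \<open>N p\<close> into Stampacchia solutions on \<open>K p\<close>. A Kakutani fixed point of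
  \<open>(p, y) \<mapsto> argmin (\<lambda>q. g y \<bullet> q) \<times> N p\<close> solves the coupled problem on \<open>K p0\<close>, and coercivity
  removes the truncation.
\<close>

section \<open>Fixed points: from Brouwer to Kakutani\<close>

text \<open>Brouwer is applied to the average of the points \<open>s t\<close> with the normalised
  weights; at a fixed point only those \<open>t\<close> with positive weight contribute. Positivity
  of a weight can encode any open relation between \<open>t\<close> and \<open>x\<close>: nearness
  in \<open>kakutani\<close>, lying outside a closed set in the KKM argument.\<close>

lemma brouwer_weights:
  fixes s :: "'i \<Rightarrow> 'a::euclidean_space"
  assumes C: "compact C" "convex C" "C \<noteq> {}"
    and T: "finite T"
    and s: "\<And>t. t \<in> T \<Longrightarrow> s t \<in> C"
    and cont: "\<And>t. t \<in> T \<Longrightarrow> continuous_on C (\<phi> t)"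
    and nonneg: "\<And>t x. t \<in> T \<Longrightarrow> x \<in> C \<Longrightarrow> 0 \<le> (\<phi> t x :: real)"
    and pos: "\<And>x. x \<in> C \<Longrightarrow> \<exists>t\<in>T. 0 < \<phi> t x"
  shows "\<exists>x\<in>C. x \<in> convex hull (s ` {t \<in> T. 0 < \<phi> t x})"
proof -
  define \<Phi> where "\<Phi> x = (\<Sum>t\<in>T. \<phi> t x)" for x
  define f where "f x = (\<Sum>t\<in>T. (\<phi> t x / \<Phi> x) *\<^sub>R s t)" for x
  have \<Phi>_pos: "0 < \<Phi> x" if "x \<in> C" for x
    using pos[OF that] nonneg[OF _ that] T unfolding \<Phi>_def by (metis sum_pos2)
  have f_hull: "f x \<in> convex hull (s ` {t \<in> T. 0 < \<phi> t x})" if "x \<in> C" for x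
  proof -
    have zero: "\<phi> t x = 0" if "t \<in> T - {t \<in> T. 0 < \<phi> t x}" for t
      using nonneg[of t x] that \<open>x \<in> C\<close> by force
    have "f x = (\<Sum>t\<in>{t \<in> T. 0 < \<phi> t x}. (\<phi> t x / \<Phi> x) *\<^sub>R s t)"
      unfolding f_def using T zero by (intro sum.mono_neutral_right) auto
    moreover have "(\<Sum>t\<in>{t \<in> T. 0 < \<phi> t x}. \<phi> t x / \<Phi> x) = (\<Sum>t\<in>T. \<phi> t x / \<Phi> x)"
      using T zero by (intro sum.mono_neutral_left) auto
    moreover have "\<dots> = 1"
      using \<Phi>_pos[OF that] by (simp add: \<Phi>_def flip: sum_divide_distrib)
    moreover have "(\<Sum>t\<in>{t \<in> T. 0 < \<phi> t x}. (\<phi> t x / \<Phi> x) *\<^sub>R s t)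
        \<in> convex hull (s ` {t \<in> T. 0 < \<phi> t x})"
      if "(\<Sum>t\<in>{t \<in> T. 0 < \<phi> t x}. \<phi> t x / \<Phi> x) = 1"
      using T \<Phi>_pos[OF \<open>x \<in> C\<close>] that
      by (intro convex_sum[OF _ convex_convex_hull]) (auto intro: hull_inc less_imp_le)
    ultimately show ?thesis by simp
  qed
  have "continuous_on C f"
    unfolding f_def \<Phi>_def
    using \<Phi>_pos by (intro continuous_intros cont) (force simp: \<Phi>_def)+
  moreover have "f \<in> C \<rightarrow> C"
  proof
    fix x assume "x \<in> C"
    have "convex hull (s ` {t \<in> T. 0 < \<phi> t x}) \<subseteq> C"
      using s C by (intro hull_minimal) auto
    then show "f x \<in> C" using f_hull[OF \<open>x \<in> C\<close>] by blast
  qed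
  ultimately obtain x where "x \<in> C" "f x = x"
    using brouwer[OF C] by blast
  then show ?thesis using f_hull[of x] by auto
qed

text \<open>Averaging a selection over finite nets gives points that lie in the convex hull of the
  values of \<open>F\<close> at nearby points. If a limit \<open>x\<close> of such points were not
  in \<open>F x\<close>, a hyperplane would separate the two; the closed graph keeps all values near
  \<open>x\<close> beyond it, hence also their hulls, while the approximating points stay on the
  side of \<open>x\<close>.\<close>

lemma kakutani:
  fixes F :: "'a::euclidean_space \<Rightarrow> 'a set"
  assumes C: "compact C" "convex C" "C \<noteq> {}"
    and ne: "\<And>x. x \<in> C \<Longrightarrow> F x \<noteq> {}"
    and sub: "\<And>x. x \<in> C \<Longrightarrow> F x \<subseteq> C"
    and cvx: "\<And>x. x \<in> C \<Longrightarrow> convex (F x)"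
    and clo: "closed {(x, y). x \<in> C \<and> y \<in> F x}"
  shows "\<exists>x\<in>C. x \<in> F x"
proof (rule ccontr)
  assume no: "\<not> (\<exists>x\<in>C. x \<in> F x)"
  let ?Gr = "{(x, y). x \<in> C \<and> y \<in> F x}"
  have approx: "\<exists>x\<in>C. x \<in> convex hull (\<Union>t\<in>C \<inter> ball x \<epsilon>. F t)" if "\<epsilon> > 0" for \<epsilon>
  proof -
    obtain T where T: "finite T" "T \<subseteq> C" "C \<subseteq> (\<Union>t\<in>T. ball t \<epsilon>)"
      using seq_compact_imp_totally_bounded[OF compact_imp_seq_compact[OF C(1)]] \<open>\<epsilon> > 0\<close> by metis
    have some: "(SOME y. y \<in> F t) \<in> F t" "(SOME y. y \<in> F t) \<in> C" if "t \<in> C" for t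
      using ne[OF that] sub[OF that] some_in_eq[of "F t"] by blast+
    have "\<exists>x\<in>C. x \<in> convex hull ((\<lambda>t. SOME y. y \<in> F t) ` {t \<in> T. 0 < max 0 (\<epsilon> - dist t x)})"
    proof (rule brouwer_weights[OF C T(1)])
      fix x assume "x \<in> C"
      then obtain t where "t \<in> T" "dist t x < \<epsilon>" using T(3) by auto
      then show "\<exists>t\<in>T. 0 < max 0 (\<epsilon> - dist t x)" by (intro bexI[of _ t]) auto
    qed (use T some(2) in \<open>auto intro!: continuous_intros\<close>)
    then obtain x where "x \<in> C"
      "x \<in> convex hull ((\<lambda>t. SOME y. y \<in> F t) ` {t \<in> T. 0 < max 0 (\<epsilon> - dist t x)})" by blast
    moreover have "(\<lambda>t. SOME y. y \<in> F t) ` {t \<in> T. 0 < max 0 (\<epsilon> - dist t x)} \<subseteq> (\<Union>t\<in>C \<inter> ball x \<epsilon>. F t)"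
    proof
      fix y assume "y \<in> (\<lambda>t. SOME y. y \<in> F t) ` {t \<in> T. 0 < max 0 (\<epsilon> - dist t x)}"
      then obtain t where t: "t \<in> T" "0 < max 0 (\<epsilon> - dist t x)" "y = (SOME y. y \<in> F t)" by blast
      then have "y \<in> F t" "t \<in> C" using some T(2) by auto
      moreover have "t \<in> ball x \<epsilon>" using t(2) by (simp add: dist_commute max_def split: if_splits)
      ultimately show "y \<in> (\<Union>t\<in>C \<inter> ball x \<epsilon>. F t)" by blast
    qed
    ultimately show ?thesis by (meson hull_mono subsetD)
  qed
  have "\<exists>x. x \<in> C \<and> x \<in> convex hull (\<Union>t\<in>C \<inter> ball x (inverse (real (Suc k))). F t)" for k
    using approx[of "inverse (real (Suc k))"] by auto
  then obtain X where X: "\<And>k. X k \<in> C"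
      "\<And>k. X k \<in> convex hull (\<Union>t\<in>C \<inter> ball (X k) (inverse (real (Suc k))). F t)"
    by metis
  obtain x \<sigma> where x: "x \<in> C" "strict_mono \<sigma>" "(X \<circ> \<sigma>) \<longlonglongrightarrow> x"
    using C(1) X(1) unfolding compact_def by metis
  have "closed (F x)"
  proof -
    have "closed (Pair x -` ?Gr)"
      using clo by (intro closed_vimage continuous_intros)
    moreover have "Pair x -` ?Gr = F x" using x(1) by auto
    ultimately show ?thesis by simp
  qed
  then obtain a b where ab: "a \<bullet> x < b" "\<And>y. y \<in> F x \<Longrightarrow> b < a \<bullet> y"
    using separating_hyperplane_closed_point[OF cvx] no x(1) by meson
  \<comment> \<open>\<open>B\<close> is the part of the graph on the wrong side of the hyperplane.
    By compactness its projection is closed, so all points of \<open>C\<close> in some ball around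
    \<open>x\<close> have their values beyond the hyperplane.\<close>
  define B where "B = ?Gr \<inter> {z. a \<bullet> snd z \<le> b}"
  have "closed B"
    unfolding B_def using clo by (intro closed_Int closed_Collect_le continuous_intros)
  moreover have "B \<subseteq> C \<times> C" using sub by (auto simp: B_def)
  ultimately have "compact B"
    using compact_Times[OF C(1) C(1)] by (metis compact_Int_closed inf.absorb_iff2)
  then have "closed (fst ` B)"
    by (intro compact_imp_closed compact_continuous_image continuous_intros)
  moreover have "x \<notin> fst ` B" using ab by (force simp: B_def)
  ultimately obtain \<delta> where \<delta>: "\<delta> > 0" "ball x \<delta> \<subseteq> - (fst ` B)"
    by (metis ComplI open_Compl open_contains_ball)
  have near: "a \<bullet> y > b" if "t \<in> C" "dist x t < \<delta>" "y \<in> F t" for t y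
  proof (rule ccontr)
    assume "\<not> a \<bullet> y > b"
    then have "(t, y) \<in> B" using that by (auto simp: B_def)
    then have "t \<in> fst ` B" by force
    then show False using \<delta> that by auto
  qed
  have lim0: "(\<lambda>k. inverse (real (Suc (\<sigma> k)))) \<longlonglongrightarrow> 0"
    using LIMSEQ_subseq_LIMSEQ[OF LIMSEQ_inverse_real_of_nat x(2)] by (simp add: o_def)
  have "\<forall>\<^sub>F k in sequentially. inverse (real (Suc (\<sigma> k))) < \<delta> / 2"
    using order_tendstoD(2)[OF lim0 half_gt_zero[OF \<delta>(1)]] .
  moreover have "\<forall>\<^sub>F k in sequentially. dist (X (\<sigma> k)) x < \<delta> / 2"
    using tendstoD[OF x(3) half_gt_zero[OF \<delta>(1)]] by simp
  moreover have "\<forall>\<^sub>F k in sequentially. a \<bullet> X (\<sigma> k) < b"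
    using order_tendstoD(2)[OF tendsto_inner[OF tendsto_const x(3)] ab(1)] by simp
  ultimately have "\<forall>\<^sub>F k in sequentially. inverse (real (Suc (\<sigma> k))) < \<delta> / 2 \<and>
      dist (X (\<sigma> k)) x < \<delta> / 2 \<and> a \<bullet> X (\<sigma> k) < b"
    by (intro eventually_conj)
  then obtain k where k: "inverse (real (Suc (\<sigma> k))) < \<delta> / 2"
      "dist (X (\<sigma> k)) x < \<delta> / 2" "a \<bullet> X (\<sigma> k) < b"
    using eventually_happens'[OF sequentially_bot] by blast
  have "convex hull (\<Union>t\<in>C \<inter> ball (X (\<sigma> k)) (inverse (real (Suc (\<sigma> k)))). F t) \<subseteq> {y. a \<bullet> y > b}"
  proof (rule hull_minimal)
    show "(\<Union>t\<in>C \<inter> ball (X (\<sigma> k)) (inverse (real (Suc (\<sigma> k)))). F t) \<subseteq> {y. a \<bullet> y > b}"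
    proof safe
      fix t y assume t: "t \<in> C" "t \<in> ball (X (\<sigma> k)) (inverse (real (Suc (\<sigma> k))))" "y \<in> F t"
      have "dist x t \<le> dist x (X (\<sigma> k)) + dist (X (\<sigma> k)) t" by (rule dist_triangle)
      also have "\<dots> < \<delta> / 2 + \<delta> / 2"
        using t(2) k(1,2) by (intro add_strict_mono) (auto simp only: mem_ball dist_commute)
      finally have "dist x t < \<delta>" by simp
      then show "a \<bullet> y > b" using near t by blast
    qed
  qed (rule convex_halfspace_gt)
  then have "a \<bullet> X (\<sigma> k) > b" using X(2)[of "\<sigma> k"] by blast
  then show False using k(3) by simp
qed

section \<open>Variational inequalities on a fixed convex set\<close>

text \<open>By compactness, finitely many closed sets \<open>F z\<close> have to meet. Otherwise the
  distances to them are admissible weights and give an \<open>x\<close> in the hull of those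
  \<open>z\<close> with \<open>x\<close> outside \<open>F z\<close>. The contrapositive of
  pseudomonotonicity puts all these \<open>z\<close> strictly below \<open>x\<close> in any
  direction from \<open>T x\<close>, and so \<open>x\<close> strictly below itself.\<close>

lemma minty_solution_exists:
  fixes K :: "'a::euclidean_space set"
  assumes K: "compact K" "convex K" "K \<noteq> {}"
    and ne: "\<And>x. x \<in> K \<Longrightarrow> T x \<noteq> {}"
    and pm: "pseudomonotone_over K T"
  shows "\<exists>y\<in>K. \<forall>z\<in>K. \<forall>z'\<in>T z. z' \<bullet> (z - y) \<ge> 0"
proof -
  define F where "F z = K \<inter> (\<Inter>z'\<in>T z. {y. z' \<bullet> y \<le> z' \<bullet> z})" for z
  have F_iff: "y \<in> F z \<longleftrightarrow> y \<in> K \<and> (\<forall>z'\<in>T z. z' \<bullet> (z - y) \<ge> 0)" for y z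
    by (auto simp: F_def inner_diff_right)
  have F_closed: "closed (F z)" for z
    unfolding F_def using K by (intro closed_Int closed_INT compact_imp_closed ballI closed_halfspace_le)
  have "K \<inter> (\<Inter>z\<in>K. F z) \<noteq> {}"
  proof (rule compact_imp_fip_image[OF K(1) F_closed])
    fix I assume I: "finite I" "I \<subseteq> K"
    show "K \<inter> (\<Inter>z\<in>I. F z) \<noteq> {}"
    proof
      assume empty: "K \<inter> (\<Inter>z\<in>I. F z) = {}"
      have infdist_pos: "0 < infdist y (F z) \<longleftrightarrow> y \<notin> F z" if "z \<in> I" for y z
      proof -
        \<comment> \<open>\<open>infdist\<close> to the empty set is 0 by default, so positive
          distance means non-membership only because \<open>z\<close> itself lies in
          \<open>F z\<close>.\<close>
        have "F z \<noteq> {}" using that I F_iff[of z z] by auto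
        then show ?thesis
          using in_closed_iff_infdist_zero[OF F_closed] infdist_nonneg[of y "F z"] by force
      qed
      have "\<exists>x\<in>K. x \<in> convex hull (id ` {z \<in> I. 0 < infdist x (F z)})"
      proof (rule brouwer_weights[OF K I(1)])
        fix x assume "x \<in> K"
        then show "\<exists>t\<in>I. 0 < infdist x (F t)" using empty infdist_pos by blast
      qed (use I in \<open>auto intro: infdist_nonneg continuous_on_infdist continuous_on_id\<close>)
      then obtain x where x: "x \<in> K" "x \<in> convex hull {z \<in> I. 0 < infdist x (F z)}"
        by auto
      obtain x' where x': "x' \<in> T x" using ne x by blast
      have "{z \<in> I. 0 < infdist x (F z)} \<subseteq> {z. x' \<bullet> z < x' \<bullet> x}"
      proof safe
        fix z assume "z \<in> I" "0 < infdist x (F z)"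
        then have "z \<in> K" "x \<notin> F z"
          using I infdist_pos by blast+
        then have "\<exists>z'\<in>T z. \<not> z' \<bullet> (z - x) \<ge> 0"
          using F_iff x(1) by blast
        then have "\<not> x' \<bullet> (z - x) \<ge> 0"
          using pm x(1) x' \<open>z \<in> K\<close> unfolding pseudomonotone_over_def by blast
        then show "x' \<bullet> z < x' \<bullet> x" by (simp add: inner_diff_right)
      qed
      then have "convex hull {z \<in> I. 0 < infdist x (F z)} \<subseteq> {z. x' \<bullet> z < x' \<bullet> x}"
        by (intro hull_minimal convex_halfspace_lt)
      then show False using x by auto
    qed
  qed
  then show ?thesis using F_iff by blast
qed

text \<open>The point \<open>a\<close>, which may first depend on \<open>b\<close>, is made uniform.
  If that fails, the compact set \<open>A\<close> misses the dual cone \<open>D\<close> of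
  \<open>B\<close> and is strictly separated from it by some \<open>d\<close>. Compactness is asked
  of \<open>A\<close> alone, since \<open>B\<close> will be a translated interior.\<close>

lemma inner_nonneg_minimax:
  fixes A B :: "'a::euclidean_space set"
  assumes A: "compact A" "convex A" "A \<noteq> {}"
    and B: "convex B" "B \<noteq> {}"
    and AB: "\<And>b. b \<in> B \<Longrightarrow> \<exists>a\<in>A. a \<bullet> b \<ge> 0"
  shows "\<exists>a\<in>A. \<forall>b\<in>B. a \<bullet> b \<ge> 0"
proof (rule ccontr)
  assume no: "\<not> ?thesis"
  define D where "D = (\<Inter>b\<in>B. {a. b \<bullet> a \<ge> 0})"
  have D_iff: "a \<in> D \<longleftrightarrow> (\<forall>b\<in>B. a \<bullet> b \<ge> 0)" for a
    by (auto simp: D_def inner_commute)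
  have "closed D" "convex D"
    unfolding D_def by (auto intro!: closed_INT convex_INT closed_halfspace_ge convex_halfspace_ge)
  then obtain d \<beta> where sep: "\<And>a. a \<in> A \<Longrightarrow> d \<bullet> a < \<beta>" "\<And>a. a \<in> D \<Longrightarrow> d \<bullet> a > \<beta>"
    using separating_hyperplane_compact_closed[OF A(2,1,3), of D] no D_iff by blast
  have "0 \<in> D" by (simp add: D_iff)
  then have "\<beta> < 0" using sep(2) by force
  have d_nonneg: "d \<bullet> a \<ge> 0" if "a \<in> D" for a
  proof (rule ccontr)
    assume neg: "\<not> d \<bullet> a \<ge> 0"
    \<comment> \<open>Scaling inside the cone \<open>D\<close> brings the negative value at
      \<open>a\<close> to exactly \<beta>, which strict separation forbids.\<close>
    define t where "t = \<beta> / (d \<bullet> a)"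
    have "t \<ge> 0" unfolding t_def using neg \<open>\<beta> < 0\<close> by (simp add: divide_nonpos_neg)
    then have "t *\<^sub>R a \<in> D" using that by (simp add: D_iff)
    moreover have "d \<bullet> (t *\<^sub>R a) = \<beta>" using neg by (simp add: t_def)
    ultimately show False using sep(2) by force
  qed
  \<comment> \<open>Bipolar theorem: \<open>d\<close> is nonnegative on the dual cone of \<open>B\<close>. Some \<open>b \<in> B\<close> close to a
    multiple of \<open>d\<close> is then negative on all of \<open>A\<close>.\<close>
  have "d \<in> closure (cone hull B)"
  proof (rule ccontr)
    assume "d \<notin> closure (cone hull B)"
    then obtain e \<gamma> where e: "e \<bullet> d < \<gamma>" "\<And>l. l \<in> closure (cone hull B) \<Longrightarrow> e \<bullet> l > \<gamma>"
      using separating_hyperplane_closed_point[OF convex_closure[OF convex_cone_hull[OF B(1)]] closed_closure]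
      by meson
    have ray: "e \<bullet> (t *\<^sub>R b) > \<gamma>" if "b \<in> B" "t \<ge> 0" for b t
      using e(2) that closure_subset cone_hull_expl[of B] by blast
    obtain b0 where "b0 \<in> B" using B(2) by blast
    then have "\<gamma> < 0" using ray[of b0 0] by simp
    have "e \<bullet> b \<ge> 0" if "b \<in> B" for b
    proof (rule ccontr)
      assume neg: "\<not> e \<bullet> b \<ge> 0"
      have "e \<bullet> ((\<gamma> / (e \<bullet> b)) *\<^sub>R b) = \<gamma>" using neg by simp
      moreover have "\<gamma> / (e \<bullet> b) \<ge> 0" using neg \<open>\<gamma> < 0\<close> by (simp add: divide_nonpos_neg)
      ultimately show False using ray[OF that] by force
    qed
    then have "d \<bullet> e \<ge> 0" using d_nonneg D_iff by blast
    then show False using e(1) \<open>\<gamma> < 0\<close> by (simp add: inner_commute)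
  qed
  obtain R where R: "R > 0" "\<And>a. a \<in> A \<Longrightarrow> norm a \<le> R"
    using compact_imp_bounded[OF A(1)] bounded_pos by metis
  \<comment> \<open>With \<open>A\<close> inside the ball of radius \<open>R\<close>, this tolerance
    limits the change of \<open>a \<bullet> d\<close> to at most -\<beta>, which cannot lift a value
    below \<beta> to 0.\<close>
  obtain l where l: "l \<in> cone hull B" "dist l d < - \<beta> / R"
    using \<open>d \<in> closure (cone hull B)\<close> \<open>\<beta> < 0\<close> R(1)
    by (metis closure_approachable divide_pos_pos neg_0_less_iff_less)
  obtain t b where tb: "t \<ge> 0" "b \<in> B" "l = t *\<^sub>R b"
    using l(1) unfolding cone_hull_expl by blast
  obtain a where a: "a \<in> A" "a \<bullet> b \<ge> 0" using AB tb by blast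
  have "a \<bullet> l = a \<bullet> d + a \<bullet> (l - d)" by (simp add: inner_diff_right)
  also have "a \<bullet> (l - d) \<le> norm a * norm (l - d)" by (rule norm_cauchy_schwarz)
  also have "\<dots> \<le> R * (- \<beta> / R)"
    using R a l(2) by (intro mult_mono) (auto simp: dist_norm)
  also have "\<dots> = - \<beta>" using R by simp
  finally have "a \<bullet> l < 0" using sep(1)[OF a(1)] by (simp add: inner_commute)
  then show False using a tb by (simp add: mult_less_0_iff)
qed


lemma small_scaling:
  fixes v :: "'a::real_normed_vector"
  assumes "e > 0"
  obtains t where "0 < t" "t \<le> 1" "t * norm v < e"
proof -
  define t where "t = min 1 (e / (norm v + 1))"
  have "t * norm v \<le> e / (norm v + 1) * norm v"
    unfolding t_def by (intro mult_right_mono) auto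
  also have "\<dots> < e"
    using assms by (simp add: field_simps add_pos_nonneg)
  finally show ?thesis
    using that[of t] assms by (simp add: t_def add_nonneg_pos)
qed

text \<open>The open segment from \<open>y\<close> to an interior point stays in the interior, so
  the Minty inequality along it is the premise of sign-continuity. The resulting vector depends on
  the test point; the minimax lemma makes it uniform, which is why \<psi> with compact convex values
  replaces \<open>T\<close>. Density of the interior in \<open>K\<close> then gives all test
  points.\<close>

lemma minty_interior_imp_stampacchia:
  fixes K :: "'a::euclidean_space set"
  assumes K: "convex K" "interior K \<noteq> {}"
    and y: "y \<in> K"
    and usc: "locally_upper_sign_continuous_at y T"
    and minty: "\<And>z z'. z \<in> interior K \<Longrightarrow> z' \<in> T z \<Longrightarrow> z' \<bullet> (z - y) \<ge> 0"
  shows "\<exists>y'\<in>T y. \<forall>z\<in>K. y' \<bullet> (z - y) \<ge> 0"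
proof -
  obtain N \<psi> where N: "open N" "convex N" "y \<in> N" "upper_sign_continuous_over N \<psi>"
    and \<psi>: "\<And>x. x \<in> N \<Longrightarrow> \<psi> x \<noteq> {} \<and> convex (\<psi> x) \<and> compact (\<psi> x) \<and> \<psi> x \<subseteq> T x - {0}"
    using usc unfolding locally_upper_sign_continuous_at_def by blast
  \<comment> \<open>The premise of sign-continuity needs the whole segment to lie in the neighbourhood \<open>N\<close>; a
    distant \<open>z\<close> is then moved towards \<open>y\<close>, which does not change the sign.\<close>
  have local: "\<exists>w\<in>\<psi> y. w \<bullet> (z - y) \<ge> 0" if z: "z \<in> interior K" "z \<in> N" for z
  proof -
    have "0 \<le> (INF w\<in>\<psi> (s *\<^sub>R y + (1 - s) *\<^sub>R z). ereal (w \<bullet> (z - y)))"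
      if s: "s \<in> {0<..<1}" for s
    proof (rule INF_greatest)
      fix w assume w: "w \<in> \<psi> (s *\<^sub>R y + (1 - s) *\<^sub>R z)"
      have "s *\<^sub>R y + (1 - s) *\<^sub>R z \<in> N"
        using N z s by (intro convexD) auto
      then have wT: "w \<in> T (s *\<^sub>R y + (1 - s) *\<^sub>R z)" using w \<psi> by blast
      have "y - (1 - s) *\<^sub>R (y - z) \<in> interior K"
        using s by (intro mem_interior_convex_shrink K z y) auto
      also have "y - (1 - s) *\<^sub>R (y - z) = s *\<^sub>R y + (1 - s) *\<^sub>R z"
        by (simp add: algebra_simps)
      finally have "w \<bullet> (s *\<^sub>R y + (1 - s) *\<^sub>R z - y) \<ge> 0"
        using minty wT by blast
      also have "s *\<^sub>R y + (1 - s) *\<^sub>R z - y = (1 - s) *\<^sub>R (z - y)"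
        by (simp add: algebra_simps)
      finally show "0 \<le> ereal (w \<bullet> (z - y))"
        using s by (simp add: zero_le_mult_iff)
    qed
    then have sup: "0 \<le> (SUP w\<in>\<psi> y. ereal (w \<bullet> (z - y)))"
      using N(3,4) z(2) unfolding upper_sign_continuous_over_def by blast
    \<comment> \<open>The supremum is attained on the compact set \<open>\<psi> y\<close>, so its
      sign is that of an actual vector.\<close>
    obtain w where w: "w \<in> \<psi> y" "\<And>v. v \<in> \<psi> y \<Longrightarrow> v \<bullet> (z - y) \<le> w \<bullet> (z - y)"
      using continuous_attains_sup[of "\<psi> y" "\<lambda>v. v \<bullet> (z - y)"] \<psi>[OF N(3)]
        continuous_on_inner[OF continuous_on_id continuous_on_const] by blast
    have "(SUP w\<in>\<psi> y. ereal (w \<bullet> (z - y))) \<le> ereal (w \<bullet> (z - y))"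
      using w(2) by (intro SUP_least) auto
    then have "0 \<le> ereal (w \<bullet> (z - y))" using sup by (rule order_trans[rotated])
    then show ?thesis using w(1) by auto
  qed
  obtain e where e: "e > 0" "ball y e \<subseteq> N"
    using N openE by blast
  have "\<exists>w\<in>\<psi> y. w \<bullet> (z - y) \<ge> 0" if z: "z \<in> interior K" for z
  proof -
    obtain t where t: "0 < t" "t \<le> 1" "t * norm (y - z) < e"
      using small_scaling[OF e(1)] by blast
    have "y - t *\<^sub>R (y - z) \<in> interior K"
      by (intro mem_interior_convex_shrink K z y t)
    moreover have "y - t *\<^sub>R (y - z) \<in> N"
      using e(2) t by (auto simp: dist_norm)
    ultimately obtain w where "w \<in> \<psi> y" "w \<bullet> (y - t *\<^sub>R (y - z) - y) \<ge> 0"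
      using local by blast
    moreover have "y - t *\<^sub>R (y - z) - y = t *\<^sub>R (z - y)"
      by (simp add: algebra_simps)
    ultimately show ?thesis
      using t(1) by (auto simp: zero_le_mult_iff)
  qed
  then have "\<exists>a\<in>\<psi> y. \<forall>b\<in>(\<lambda>z. z - y) ` interior K. a \<bullet> b \<ge> 0"
    using \<psi>[OF N(3)] K by (intro inner_nonneg_minimax) auto
  then obtain a where a: "a \<in> \<psi> y" "\<And>z. z \<in> interior K \<Longrightarrow> a \<bullet> (z - y) \<ge> 0"
    by blast
  have "interior K \<subseteq> {z. a \<bullet> z \<ge> a \<bullet> y}"
    using a(2) by (auto simp: inner_diff_right)
  then have "closure (interior K) \<subseteq> {z. a \<bullet> z \<ge> a \<bullet> y}"
    by (intro closure_minimal closed_halfspace_ge)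
  then have "K \<subseteq> {z. a \<bullet> z \<ge> a \<bullet> y}"
    using convex_closure_interior[OF K] closure_subset by blast
  then show ?thesis
    using a(1) \<psi>[OF N(3)] by (auto simp: inner_diff_right)
qed

section \<open>Stability of interior points, and removal of a truncation\<close>

text \<open>Lower semicontinuity makes \<open>M q\<close> meet small balls around a finite net of a
  sphere about \<open>z\<close>; finiteness keeps the neighbourhood of \<open>p\<close> open. A
  convex set with points near every part of the sphere cannot lie on one side of a hyperplane
  through \<open>z\<close>.\<close>

lemma lower_semicontinuous_interior:
  fixes M :: "'p::topological_space \<Rightarrow> 'a::euclidean_space set"
  assumes lsc: "lower_semicontinuous_map_on P M"
    and cvx: "\<And>q. q \<in> P \<Longrightarrow> convex (M q)"
    and int: "\<And>q. q \<in> P \<Longrightarrow> interior (M q) \<noteq> {}"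
    and p: "p \<in> P" "z \<in> interior (M p)"
  shows "\<exists>U. open U \<and> p \<in> U \<and> (\<forall>q\<in>U \<inter> P. z \<in> interior (M q))"
proof -
  obtain \<delta> where \<delta>: "\<delta> > 0" "cball z \<delta> \<subseteq> M p"
    using p(2) by (meson mem_interior_cball)
  obtain T where T: "finite T" "T \<subseteq> sphere z \<delta>" "sphere z \<delta> \<subseteq> (\<Union>t\<in>T. ball t (\<delta> / 2))"
    using seq_compact_imp_totally_bounded[OF compact_imp_seq_compact[OF compact_sphere]] \<delta>(1)
    by (metis half_gt_zero)
  have "\<exists>U. open U \<and> p \<in> U \<and> (\<forall>q\<in>U \<inter> P. M q \<inter> ball t (\<delta> / 2) \<noteq> {})" if "t \<in> T" for t
  proof -
    have "t \<in> M p \<inter> ball t (\<delta> / 2)" using that T(2) \<delta> by (auto simp: subset_iff)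
    then show ?thesis
      using lsc p(1) unfolding lower_semicontinuous_map_on_def by (metis empty_iff open_ball)
  qed
  then obtain U where U: "\<And>t. t \<in> T \<Longrightarrow> open (U t) \<and> p \<in> U t"
      "\<And>t q. t \<in> T \<Longrightarrow> q \<in> U t \<inter> P \<Longrightarrow> M q \<inter> ball t (\<delta> / 2) \<noteq> {}"
    by metis
  have "z \<in> interior (M q)" if q: "q \<in> (\<Inter>t\<in>T. U t) \<inter> P" for q
  proof (rule ccontr)
    assume "z \<notin> interior (M q)"
    then obtain a b where a: "a \<noteq> 0" "a \<bullet> z \<le> b" "\<And>x. x \<in> interior (M q) \<Longrightarrow> a \<bullet> x \<ge> b"
      using separating_hyperplane_sets[of "{z}" "interior (M q)"] cvx int q by auto
    have "closure (interior (M q)) \<subseteq> {x. a \<bullet> x \<ge> b}"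
      using a(3) by (intro closure_minimal closed_halfspace_ge) auto
    then have above: "a \<bullet> x \<ge> a \<bullet> z" if "x \<in> M q" for x
      using convex_closure_interior[of "M q"] cvx int q closure_subset[of "M q"] that a(2) by force
    \<comment> \<open>The point of the sphere deepest below the hyperplane, at depth \<delta>. A net
      point and then a point of \<open>M q\<close> are each less than \<open>\<delta> / 2\<close>
      away, too close to get back above.\<close>
    define x where "x = z - (\<delta> / norm a) *\<^sub>R a"
    have "x \<in> sphere z \<delta>" using \<delta>(1) a(1) by (simp add: x_def dist_norm)
    then obtain t where t: "t \<in> T" "dist t x < \<delta> / 2" using T(3) by auto
    then obtain x' where x': "x' \<in> M q" "dist t x' < \<delta> / 2" using U(2)[of t q] q by auto
    have "dist x' x \<le> dist t x' + dist t x" by (rule dist_triangle3)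
    then have "norm (x' - x) < \<delta>" using t x' by (simp add: dist_norm)
    then have "norm a * norm (x' - x) < norm a * \<delta>" using a(1) by simp
    moreover have "a \<bullet> (x' - x) \<le> norm a * norm (x' - x)" by (rule norm_cauchy_schwarz)
    moreover have "a \<bullet> x = a \<bullet> z - norm a * \<delta>"
      using a(1) by (simp add: x_def inner_diff_right power2_norm_eq_inner[symmetric] power2_eq_square)
    ultimately have "a \<bullet> x' < a \<bullet> z" by (simp add: inner_diff_right)
    then show False using above[OF x'(1)] by simp
  qed
  then show ?thesis using T(1) U(1) by (intro exI[of _ "\<Inter>t\<in>T. U t"]) auto
qed

text \<open>The point \<open>z0\<close> minimises \<open>w\<close> on the truncated set and lies
  strictly inside the ball, so a short step from it towards any \<open>z\<close> remains admissible:
  a local minimum of a linear function on a convex set is global.\<close>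

lemma stampacchia_cball_imp_global:
  fixes S :: "'a::real_inner set"
  assumes "convex S" and z0: "z0 \<in> S" "norm z0 < r" "w \<bullet> (z0 - y) \<le> 0"
    and ball: "\<And>z. z \<in> S \<inter> cball 0 r \<Longrightarrow> w \<bullet> (z - y) \<ge> 0"
    and z: "z \<in> S"
  shows "w \<bullet> (z - y) \<ge> 0"
proof -
  obtain t where t: "0 < t" "t \<le> 1" "t * norm (z - z0) < r - norm z0"
    using small_scaling[of "r - norm z0"] z0(2) by auto
  define x where "x = (1 - t) *\<^sub>R z0 + t *\<^sub>R z"
  have x_eq: "x = z0 + t *\<^sub>R (z - z0)" by (simp add: x_def algebra_simps)
  have "x \<in> S" unfolding x_def using assms t by (intro convexD) auto
  moreover have "norm x \<le> r"
    unfolding x_eq using norm_triangle_ineq[of z0 "t *\<^sub>R (z - z0)"] t by simp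
  ultimately have "w \<bullet> (x - y) \<ge> 0" using ball by simp
  moreover have "w \<bullet> (z0 - y) = 0" using ball[of z0] z0 by simp
  ultimately have "t * (w \<bullet> (z - z0)) \<ge> 0" by (simp add: x_eq inner_simps)
  then have "w \<bullet> (z - z0) \<ge> 0" using t by (simp add: zero_le_mult_iff)
  then show ?thesis using \<open>w \<bullet> (z0 - y) = 0\<close> by (simp add: inner_diff_right)
qed

section \<open>The coupled problem\<close>

theorem theorem3p1:
  fixes g :: "real ^ 'n \<Rightarrow> real ^ 'm"
    and P :: "(real ^ 'm) set"
    and M :: "real ^ 'm \<Rightarrow> (real ^ 'n) set"
    and G :: "real ^ 'n \<Rightarrow> (real ^ 'n) set"
    and \<rho> :: "real ^ 'm \<Rightarrow> real"
  assumes "affine_map g"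
    and "P \<noteq> {}" and "convex P" and "compact P"
    and "\<forall>p\<in>P. convex (M p)"
    and "lower_semicontinuous_map_on P M"
    and "closed_graph_on P M"
    and "\<forall>p\<in>P. interior (M p) \<noteq> {}"
    and "locally_upper_sign_continuous_over (convex hull (\<Union>p\<in>P. M p)) G"
    and "pseudomonotone_over (convex hull (\<Union>p\<in>P. M p)) G"
    and "\<forall>p\<in>P. \<rho> p > 0 \<and> coercivity_condition G M p (\<rho> p)"
    and "bdd_above (\<rho> ` P)"
    and "\<exists>r. r > (SUP p\<in>P. \<rho> p) \<and> (\<forall>p\<in>P. M p \<inter> cball 0 r \<noteq> {})"
  shows "\<exists>p0\<in>P. \<exists>y0\<in>M p0. \<exists>y0'\<in>G y0.
           \<forall>p\<in>P. \<forall>z\<in>M p0. g y0 \<bullet> (p - p0) + y0' \<bullet> (z - y0) \<ge> 0"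
proof -
  obtain r where r: "r > (SUP p\<in>P. \<rho> p)" "\<And>p. p \<in> P \<Longrightarrow> M p \<inter> cball 0 r \<noteq> {}"
    using assms(13) by blast
  have \<rho>_less: "\<rho> p < r" if "p \<in> P" for p
    using cSUP_upper[OF that assms(12)] r(1) by simp
  define S where "S = convex hull (\<Union>p\<in>P. M p)"
  have M_S: "M p \<subseteq> S" if "p \<in> P" for p
    unfolding S_def using that by (meson UN_upper hull_subset order_trans)
  have usc: "locally_upper_sign_continuous_at y G" if "y \<in> S" for y
    using assms(9) that unfolding locally_upper_sign_continuous_over_def S_def by blast
  have G_ne: "G y \<noteq> {}" if "y \<in> S" for y
    using usc[OF that] unfolding locally_upper_sign_continuous_at_def by blast
  have M_convex: "convex (M p)" and M_int: "interior (M p) \<noteq> {}" if "p \<in> P" for p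
    using assms(5,8) that by auto
  \<comment> \<open>A point strictly inside the ball that is no worse than \<open>y\<close> for
    every vector of \<open>G y\<close>: \<open>y\<close> itself, or on the sphere the point supplied
    by coercivity. It serves both to give \<open>K p\<close> an interior and to remove the
    truncation.\<close>
  have inner_point: "\<exists>z\<in>M p. norm z < r \<and> (\<forall>w\<in>G y. w \<bullet> (z - y) \<le> 0)"
    if p: "p \<in> P" and y: "y \<in> M p" "norm y \<le> r" for p y
  proof (cases "norm y < r")
    case True
    then show ?thesis using y by (intro bexI[of _ y]) auto
  next
    case False
    then have "y \<in> M p - cball 0 (\<rho> p)" using \<rho>_less[OF p] y by auto
    then obtain z where z: "z \<in> M p" "norm z < norm y" "\<And>w. w \<in> G y \<Longrightarrow> w \<bullet> (y - z) \<ge> 0"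
      using assms(11) p unfolding coercivity_condition_def by blast
    then show ?thesis using y by (intro bexI[of _ z]) (auto simp: inner_diff_right)
  qed

  \<comment> \<open>The truncated constraint sets\<close>
  define K where "K p = M p \<inter> cball 0 r" for p
  have K_S: "K p \<subseteq> S" if "p \<in> P" for p
    using M_S[OF that] by (auto simp: K_def)
  have K_convex: "convex (K p)" and K_ne: "K p \<noteq> {}" if "p \<in> P" for p
    using M_convex[OF that] r(2)[OF that] by (auto simp: K_def intro: convex_Int)
  have int_K: "interior (K p) = interior (M p) \<inter> ball 0 r" for p
    by (simp add: K_def)
  have K_int: "interior (K p) \<noteq> {}" if p: "p \<in> P" for p
  proof -
    obtain y where "y \<in> M p" "norm y \<le> r" using K_ne[OF p] by (auto simp: K_def)
    then obtain z where z: "z \<in> M p" "norm z < r" using inner_point[OF p] by blast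
    \<comment> \<open>Since \<open>z\<close> is in the open ball and is a limit of interior points
      of \<open>M p\<close>, some of these are in the ball too; mere contact with the closed ball
      would not give this.\<close>
    have "z \<in> closure (interior (M p))"
      using convex_closure_interior[OF M_convex[OF p] M_int[OF p]] z(1) closure_subset by blast
    then have "ball 0 r \<inter> interior (M p) \<noteq> {}"
      using z(2) open_Int_closure_eq_empty[OF open_ball, of 0 r "interior (M p)"] by auto
    then show ?thesis by (auto simp: int_K)
  qed
  have graph_M: "closed {(p, y). p \<in> P \<and> y \<in> M p}"
    using assms(7) closedin_closed_trans closed_Times[OF compact_imp_closed[OF assms(4)] closed_UNIV]
    unfolding closed_graph_on_def by blast
  have graph_K: "closed {(p, y). p \<in> P \<and> y \<in> K p}"
  proof -
    have "{(p, y). p \<in> P \<and> y \<in> K p} = {(p, y). p \<in> P \<and> y \<in> M p} \<inter> UNIV \<times> cball 0 r"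
      by (auto simp: K_def)
    then show ?thesis using graph_M by (simp add: closed_Int closed_Times)
  qed
  have K_closed: "closed (K p)" if "p \<in> P" for p
  proof -
    have "K p = Pair p -` {(p, y). p \<in> P \<and> y \<in> K p}" using that by auto
    moreover have "closed (Pair p -` {(p, y). p \<in> P \<and> y \<in> K p})"
      using graph_K by (intro closed_vimage continuous_intros)
    ultimately show ?thesis by simp
  qed
  have K_compact: "compact (K p)" if "p \<in> P" for p
    using K_closed[OF that] by (auto simp: compact_eq_bounded_closed K_def intro: bounded_subset)

  \<comment> \<open>The map of Minty solutions and its closed graph\<close>
  define N where "N p = {y \<in> K p. \<forall>z\<in>interior (K p). \<forall>z'\<in>G z. z' \<bullet> (z - y) \<ge> 0}" for p
  have N_convex: "convex (N p)" if "p \<in> P" for p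
  proof -
    have "N p = K p \<inter> (\<Inter>z\<in>interior (K p). \<Inter>z'\<in>G z. {y. z' \<bullet> y \<le> z' \<bullet> z})"
      by (auto simp: N_def inner_diff_right)
    then show ?thesis
      using K_convex[OF that] by (auto intro!: convex_Int convex_INT convex_halfspace_le)
  qed
  have N_ne: "N p \<noteq> {}" if p: "p \<in> P" for p
  proof -
    have "pseudomonotone_over (K p) G"
      using assms(10) K_S[OF p] unfolding pseudomonotone_over_def S_def[symmetric] by blast
    then obtain y where "y \<in> K p" "\<And>z z'. z \<in> K p \<Longrightarrow> z' \<in> G z \<Longrightarrow> z' \<bullet> (z - y) \<ge> 0"
      using minty_solution_exists[OF K_compact[OF p] K_convex[OF p] K_ne[OF p], of G] G_ne K_S[OF p]
      by blast
    then have "y \<in> N p" using interior_subset[of "K p"] by (auto simp: N_def)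
    then show ?thesis by blast
  qed
  have graph_N: "closed {(p, y). p \<in> P \<and> y \<in> N p}"
    unfolding closed_sequential_limits
  proof (intro allI impI, elim conjE)
    fix x l assume x: "\<forall>n. x n \<in> {(p, y). p \<in> P \<and> y \<in> N p}" and lim: "x \<longlonglongrightarrow> l"
    have xP: "fst (x n) \<in> P" "snd (x n) \<in> N (fst (x n))" for n
      using x by (auto simp: split_beta)
    have "\<forall>n. x n \<in> {(p, y). p \<in> P \<and> y \<in> K p}"
      using x by (auto simp: N_def split_beta)
    then have "l \<in> {(p, y). p \<in> P \<and> y \<in> K p}"
      using graph_K lim unfolding closed_sequential_limits by blast
    then have l: "fst l \<in> P" "snd l \<in> K (fst l)" by auto
    have "z' \<bullet> (z - snd l) \<ge> 0" if z: "z \<in> interior (K (fst l))" "z' \<in> G z" for z z'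
    proof (rule tendsto_lowerbound)
      show "(\<lambda>n. z' \<bullet> (z - snd (x n))) \<longlonglongrightarrow> z' \<bullet> (z - snd l)"
        by (intro tendsto_intros lim)
      obtain U where U: "open U" "fst l \<in> U" "\<And>q. q \<in> U \<inter> P \<Longrightarrow> z \<in> interior (M q)"
        using lower_semicontinuous_interior[OF assms(6) M_convex M_int l(1), of z] z(1)
        by (auto simp: int_K)
      have "\<forall>\<^sub>F n in sequentially. fst (x n) \<in> U"
        using topological_tendstoD[OF tendsto_fst[OF lim] U(1,2)] .
      then show "\<forall>\<^sub>F n in sequentially. 0 \<le> z' \<bullet> (z - snd (x n))"
      proof eventually_elim
        case (elim n)
        then have "z \<in> interior (K (fst (x n)))"
          using U(3) xP(1) z(1) by (auto simp: int_K)
        then show ?case using xP(2)[of n] z(2) by (simp add: N_def)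
      qed
    qed simp
    then show "l \<in> {(p, y). p \<in> P \<and> y \<in> N p}" using l by (auto simp: N_def split_beta)
  qed

  \<comment> \<open>Minimisers over the parameter set, and the fixed point\<close>
  define H where "H y = {q \<in> P. \<forall>p\<in>P. g y \<bullet> (p - q) \<ge> 0}" for y
  obtain h c where h: "linear h" "g = (\<lambda>x. h x + c)"
    using assms(1) unfolding affine_map_def by blast
  have cont_g: "continuous_on UNIV g"
    unfolding h(2) by (intro continuous_intros linear_continuous_on) (simp add: h linear_linear)
  have H_ne: "H y \<noteq> {}" for y
  proof -
    obtain q where "q \<in> P" "\<And>p. p \<in> P \<Longrightarrow> g y \<bullet> q \<le> g y \<bullet> p"
      using continuous_attains_inf[OF assms(4,2), of "\<lambda>q. g y \<bullet> q"]
        continuous_on_inner[OF continuous_on_const continuous_on_id] by blast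
    then have "q \<in> H y" by (simp add: H_def inner_diff_right)
    then show ?thesis by blast
  qed
  have H_convex: "convex (H y)" for y
  proof -
    have "H y = P \<inter> (\<Inter>p\<in>P. {q. g y \<bullet> q \<le> g y \<bullet> p})"
      by (auto simp: H_def inner_diff_right)
    then show ?thesis
      using assms(3) by (auto intro!: convex_Int convex_INT convex_halfspace_le)
  qed

  \<comment> \<open>Kakutani needs a fixed domain, so the second factor is the whole ball rather
    than the varying \<open>K p\<close>; membership in \<open>K p\<close> is restored by
    \<open>N\<close>. Each factor of the map depends on the other coordinate, which produces the
    coupling.\<close>
  define C where "C = P \<times> cball (0 :: real ^ 'n) r"
  have "\<exists>x\<in>C. x \<in> (\<lambda>x. H (snd x) \<times> N (fst x)) x"
  proof (rule kakutani)
    show "compact C" "convex C"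
      using assms(3,4) by (auto simp: C_def intro: compact_Times convex_Times)
    have "cball (0 :: real ^ 'n) r \<noteq> {}" using assms(2) r(2) by blast
    then show "C \<noteq> {}" using assms(2) by (auto simp: C_def)
    show "H (snd x) \<times> N (fst x) \<noteq> {}" "convex (H (snd x) \<times> N (fst x))" if "x \<in> C" for x
      using that H_ne N_ne H_convex N_convex by (auto simp: C_def intro: convex_Times)
    show "H (snd x) \<times> N (fst x) \<subseteq> C" for x
      by (auto simp: C_def H_def N_def K_def)
    have "{(x, y). x \<in> C \<and> y \<in> H (snd x) \<times> N (fst x)} =
        (C \<times> (P \<times> UNIV)) \<inter> (\<Inter>p\<in>P. {z. 0 \<le> g (snd (fst z)) \<bullet> (p - fst (snd z))}) \<inter>
        (\<lambda>z. (fst (fst z), snd (snd z))) -` {(p, y). p \<in> P \<and> y \<in> N p}"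
      by (auto simp: C_def H_def)
    also have "closed \<dots>"
    proof (intro closed_Int closed_INT ballI closed_vimage closed_Times graph_N closed_Collect_le)
      show "closed C" "closed P"
        using assms(4) by (auto simp: C_def intro: compact_imp_closed closed_Times)
      show "continuous_on UNIV (\<lambda>z::((real^'m)\<times>(real^'n))\<times>((real^'m)\<times>(real^'n)).
          g (snd (fst z)) \<bullet> (p - fst (snd z)))" for p
        by (intro continuous_intros continuous_on_compose2[OF cont_g]) auto
    qed (auto intro!: continuous_intros)
    finally show "closed {(x, y). x \<in> C \<and> y \<in> H (snd x) \<times> N (fst x)}" .
  qed

  \<comment> \<open>From the fixed point to the solution on the full constraint set\<close>
  then obtain p0 y0 where p0: "p0 \<in> P" "p0 \<in> H y0" and y0: "y0 \<in> N p0"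
    by (auto simp: C_def)
  have y0M: "y0 \<in> M p0" "norm y0 \<le> r" and y0K: "y0 \<in> K p0"
    using y0 by (auto simp: N_def K_def)
  have y0_minty: "\<And>z z'. z \<in> interior (K p0) \<Longrightarrow> z' \<in> G z \<Longrightarrow> z' \<bullet> (z - y0) \<ge> 0"
    using y0 by (auto simp: N_def)
  have "y0 \<in> S" using M_S p0(1) y0M(1) by blast
  then obtain w where w: "w \<in> G y0" "\<And>z. z \<in> K p0 \<Longrightarrow> w \<bullet> (z - y0) \<ge> 0"
    using minty_interior_imp_stampacchia[OF K_convex[OF p0(1)] K_int[OF p0(1)] y0K usc y0_minty]
    by blast
  \<comment> \<open>\<open>y0\<close> may lie on the sphere of radius \<open>r\<close>. As
    \<open>inner_point\<close> covers all of \<open>G y0\<close>, it applies to the \<open>w\<close>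
    just found.\<close>
  obtain z0 where z0: "z0 \<in> M p0" "norm z0 < r" "w \<bullet> (z0 - y0) \<le> 0"
    using inner_point[OF p0(1) y0M] w(1) by blast
  have "w \<bullet> (z - y0) \<ge> 0" if "z \<in> M p0" for z
    using stampacchia_cball_imp_global[OF M_convex[OF p0(1)] z0 _ that] w(2) by (simp add: K_def)
  moreover have "g y0 \<bullet> (p - p0) \<ge> 0" if "p \<in> P" for p
    using p0(2) that by (simp add: H_def)
  ultimately show ?thesis
    using p0(1) y0M(1) w(1) by (intro bexI[of _ p0] bexI[of _ y0] bexI[of _ w]) (auto intro: add_nonneg_nonneg)
qed

end
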